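(* Let $G$ be a graph obtained by connecting two graphs with a path, whose graph Laplacian $L$ can be expressed as $$L=\begin{bmatrix} L_1 & E_1^{\mathsf T} & 0\\ E_1 & L_2 & E_2^{\mathsf T}\\ 0 & E_2 & L_3\end{bmatrix},$$ where $L_i$ is an $\ell_i\times\ell_i$ matrix for $i=1,2,3$; $E_1$ and $E_2$ have $-1$ in the top-right corner and $0$ elsewhere; and $L_2$ represents the path, that is, $L_2$ is a tridiagonal matrix with $2$ on the diagonal and $-1$ on the off-diagonals. Let $\widetilde{\lambda}>4$ be any eigenvalue of the top-left $(\ell_1+\ell_2)\times(\ell_1+\ell_2)$ (or of the bottom-right $(\ell_2+\ell_3)\times(\ell_2+\ell_3)$) submatrix of $L$. Then there exists an eigenvalue $\lambda$ of $L$ such that $$|\lambda-\widetilde{\lambda}|\le\widetilde{\gamma}^{\,\ell_2},\qquad\text{where } \widetilde{\gamma}:=\frac{2}{\widetilde{\lambda}-2}<1.$$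
   Context: Graphs are finite, simple, unweighted and undirected. The graph Laplacian of a graph $G$ with vertices $v_1,\dots,v_n$ is $L=D-A$, where $D$ is the diagonal matrix of vertex degrees of $G$ and $A$ is the adjacency matrix ($a_{ij}=1$ if $v_i,v_j$ are adjacent, and $0$ otherwise). Here $E_1$ is $\ell_2\times\ell_1$ and $E_2$ is $\ell_3\times\ell_2$; the submatrices are taken as submatrices of the matrix $L$ itself (they are not the Laplacians of the corresponding induced subgraphs). *)

theory Defs
  imports
    Complex_Main
    "Graph_Theory.Digraph"
    "Jordan_Normal_Form.Char_Poly"
    "Jordan_Normal_Form.DL_Submatrix"
begin

text \<open>
  The locale \<^locale>\<open>graph\<close> models finite simple undirected graphs as symmetric, loop-free digraphs
  without parallel arcs: an undirected edge is a pair of opposite arcs. Hence the degree of a vertex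
  is its \<^const>\<open>out_degree\<close>, and adjacency is \<^const>\<open>dominates\<close>. The list \<open>vs\<close> enumerates the vertices
  and thereby fixes the order of the rows and columns.
\<close>

definition degree_mat :: "('a, 'b) pre_digraph \<Rightarrow> 'a list \<Rightarrow> real mat" where
  "degree_mat G vs = mat_diag (length vs) (\<lambda>i. real (out_degree G (vs ! i)))"

definition adjacency_mat :: "('a, 'b) pre_digraph \<Rightarrow> 'a list \<Rightarrow> real mat" where
  "adjacency_mat G vs =
     mat (length vs) (length vs) (\<lambda>(i, j). if vs ! i \<rightarrow>\<^bsub>G\<^esub> vs ! j then 1 else 0)"

definition graph_laplacian :: "('a, 'b) pre_digraph \<Rightarrow> 'a list \<Rightarrow> real mat" where
  "graph_laplacian G vs = degree_mat G vs - adjacency_mat G vs"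

definition three_block_mat ::
  "'a::zero mat \<Rightarrow> 'a mat \<Rightarrow> 'a mat \<Rightarrow>
   'a mat \<Rightarrow> 'a mat \<Rightarrow> 'a mat \<Rightarrow>
   'a mat \<Rightarrow> 'a mat \<Rightarrow> 'a mat \<Rightarrow> 'a mat" where
  "three_block_mat A11 A12 A13
                   A21 A22 A23
                   A31 A32 A33 =
     four_block_mat
       (four_block_mat A11 A12
                       A21 A22)                                             (A13 @\<^sub>r A23)
       (transpose_mat (transpose_mat A31 @\<^sub>r transpose_mat A32))   A33"

text \<open>Matrix indices start at \<open>0\<close>, so the top-right corner is the entry \<open>(0, nc - 1)\<close>.\<close>

definition corner_mat :: "nat \<Rightarrow> nat \<Rightarrow> real mat" where
  "corner_mat nr nc = mat nr nc (\<lambda>(i, j). if i = 0 \<and> Suc j = nc then -1 else 0)"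

definition path_mat :: "nat \<Rightarrow> real mat" where
  "path_mat n =
     mat n n (\<lambda>(i, j). if i = j then 2 else if Suc i = j \<or> Suc j = i then -1 else 0)"

end

theory Submission
  imports Defs
begin

text \<open>
  Let \<open>v\<close> be an eigenvector of the top-left submatrix for \<open>\<mu> > 4\<close>, and let \<open>x\<close> be \<open>v\<close> padded with
  zeros. Then \<open>L x - \<mu> x\<close> vanishes except in the first row below the submatrix, where the corner of
  \<open>E\<^sub>2\<close> produces minus the entry of \<open>x\<close> at the last path vertex. Two facts finish the proof.

  Along the path the eigenvalue equation is a three-term recurrence whose middle coefficient
  \<open>\<mu> - 2\<close> dominates, and it ends in a zero, namely the padding. So each entry is at most
  \<open>2 / (\<mu> - 2)\<close> times its predecessor in absolute value (\<open>three_term_decay\<close>). After \<open>l\<^sub>2\<close> steps,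
  starting at the vertex to which the path is attached, the last entry, and hence the residual, is
  at most \<open>(2 / (\<mu> - 2)) ^ l\<^sub>2\<close> times the norm of \<open>x\<close>.

  A symmetric matrix has an eigenvalue within \<open>\<parallel>L x - \<mu> x\<parallel> / \<parallel>x\<parallel>\<close> of \<open>\<mu>\<close>
  (\<open>symmetric_eigenvalue_near\<close>). The proof given here replaces the spectral theorem by a direct
  argument: for symmetric \<open>B\<close>, let \<open>m\<close> be the infimum of \<open>\<parallel>B y\<parallel>\<^sup>2 / \<parallel>y\<parallel>\<^sup>2\<close>. The positive
  semidefinite matrix \<open>B\<^sup>2 - m\<close> is not bounded below by a positive multiple of the identity, so it is
  singular (\<open>nonsingular_psd_bounded_below\<close>), and since it is \<open>(B - \<surd>m) (B + \<surd>m)\<close>, one of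
  \<open>\<surd>m\<close> and \<open>- \<surd>m\<close> is an eigenvalue of \<open>B\<close>.

  For the bottom-right submatrix the same argument applies with the path read backwards;
  \<open>eigenvalue_near_path_end\<close> therefore takes an enumeration \<open>p\<close> of the positions along the path.
\<close>

section \<open>A residual bound for symmetric matrices\<close>

lemma bilinear_form_le:
  fixes R :: "real mat"
  assumes R: "R \<in> carrier_mat n n"
  obtains K where "K > 0" "\<And>x. x \<in> carrier_vec n \<Longrightarrow> x \<bullet> (R *\<^sub>v x) \<le> K * (x \<bullet> x)"
proof
  let ?K = "1 + (\<Sum>i = 0..<n. \<Sum>j = 0..<n. \<bar>R $$ (i, j)\<bar>)"
  show "?K > 0" by (intro add_pos_nonneg sum_nonneg) auto
  fix x :: "real vec" assume x: "x \<in> carrier_vec n"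
  have nn: "0 \<le> x \<bullet> x" by (auto simp: scalar_prod_def intro!: sum_nonneg)
  have entry: "(x $ i)\<^sup>2 \<le> x \<bullet> x" if "i < n" for i
    using that x by (auto simp: scalar_prod_def power2_eq_square intro!: member_le_sum)
  have prod: "\<bar>x $ i * x $ j\<bar> \<le> x \<bullet> x" if "i < n" "j < n" for i j
    using entry[OF that(1)] entry[OF that(2)] sum_squares_bound[of "\<bar>x $ i\<bar>" "\<bar>x $ j\<bar>"]
    by (simp add: abs_mult)
  have "x \<bullet> (R *\<^sub>v x) = (\<Sum>i = 0..<n. \<Sum>j = 0..<n. R $$ (i, j) * (x $ i * x $ j))"
    using x R by (auto simp: scalar_prod_def sum_distrib_left ac_simps intro!: sum.cong)
  also have "\<dots> \<le> (\<Sum>i = 0..<n. \<Sum>j = 0..<n. \<bar>R $$ (i, j)\<bar> * (x \<bullet> x))"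
  proof (intro sum_mono)
    fix i j assume "i \<in> {0..<n}" "j \<in> {0..<n}"
    then have "\<bar>R $$ (i, j)\<bar> * \<bar>x $ i * x $ j\<bar> \<le> \<bar>R $$ (i, j)\<bar> * (x \<bullet> x)"
      using prod by (intro mult_left_mono) auto
    then show "R $$ (i, j) * (x $ i * x $ j) \<le> \<bar>R $$ (i, j)\<bar> * (x \<bullet> x)"
      using abs_ge_self[of "R $$ (i, j) * (x $ i * x $ j)"] by (simp add: abs_mult)
  qed
  also have "\<dots> = (\<Sum>i = 0..<n. \<Sum>j = 0..<n. \<bar>R $$ (i, j)\<bar>) * (x \<bullet> x)"
    by (simp add: sum_distrib_right)
  also have "\<dots> \<le> ?K * (x \<bullet> x)" using nn by (simp add: algebra_simps)
  finally show "x \<bullet> (R *\<^sub>v x) \<le> ?K * (x \<bullet> x)" .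
qed

lemma symmetric_scalar_prod:
  fixes A :: "real mat"
  assumes "A \<in> carrier_mat n n" "transpose_mat A = A" "x \<in> carrier_vec n" "y \<in> carrier_vec n"
  shows "(A *\<^sub>v x) \<bullet> y = x \<bullet> (A *\<^sub>v y)"
  using transpose_vec_mult_scalar[OF assms(1,4,3)] assms(2) by simp

text \<open>
  With \<open>R\<close> the inverse of \<open>Q\<close>, the form at \<open>x - t R x\<close> is
  \<open>x \<bullet> Q x - 2 t (x \<bullet> x) + t\<^sup>2 (x \<bullet> R x)\<close>, which is nonnegative. If \<open>x \<bullet> R x \<le> K (x \<bullet> x)\<close>, then
  \<open>t = 1 / K\<close> gives the bound with \<open>c = 1 / K\<close>, so no diagonalisation is needed.
\<close>

lemma nonsingular_psd_bounded_below:
  fixes Q :: "real mat"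
  assumes Q: "Q \<in> carrier_mat n n" "transpose_mat Q = Q" "det Q \<noteq> 0"
    and psd: "\<And>x. x \<in> carrier_vec n \<Longrightarrow> 0 \<le> x \<bullet> (Q *\<^sub>v x)"
  obtains c where "c > 0" "\<And>x. x \<in> carrier_vec n \<Longrightarrow> c * (x \<bullet> x) \<le> x \<bullet> (Q *\<^sub>v x)"
proof -
  define R where "R = (1 / det Q) \<cdot>\<^sub>m adj_mat Q"
  have R: "R \<in> carrier_mat n n" using adj_mat(1)[OF Q(1)] by (simp add: R_def)
  have "Q * R = 1\<^sub>m n"
    using Q(3) adj_mat(1,2)[OF Q(1)] mult_smult_distrib[OF Q(1) adj_mat(1)[OF Q(1)]]
    by (simp add: R_def) (auto intro!: eq_matI)
  then have QR: "Q *\<^sub>v (R *\<^sub>v x) = x" if "x \<in> carrier_vec n" for x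
    using assoc_mult_mat_vec[OF Q(1) R that] that by simp
  obtain K where K: "K > 0" "\<And>x. x \<in> carrier_vec n \<Longrightarrow> x \<bullet> (R *\<^sub>v x) \<le> K * (x \<bullet> x)"
    using bilinear_form_le[OF R] by blast
  show thesis
  proof (rule that[of "1 / K"])
    fix x :: "real vec" assume x: "x \<in> carrier_vec n"
    define z where "z = R *\<^sub>v x"
    have z: "z \<in> carrier_vec n" and Qz: "Q *\<^sub>v z = x" using R x QR by (auto simp: z_def)
    have Qx: "Q *\<^sub>v x \<in> carrier_vec n" using Q(1) x by auto
    define t where "t = 1 / K"
    have tz: "t \<cdot>\<^sub>v z \<in> carrier_vec n" using z by auto
    have "Q *\<^sub>v (x - t \<cdot>\<^sub>v z) = Q *\<^sub>v x - t \<cdot>\<^sub>v x"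
      using mult_minus_distrib_mat_vec[OF Q(1) x tz] mult_mat_vec[OF Q(1) z, of t] Qz by simp
    moreover have "z \<bullet> (Q *\<^sub>v x) = x \<bullet> x"
      using symmetric_scalar_prod[OF Q(1,2) z x] Qz by simp
    ultimately have "(x - t \<cdot>\<^sub>v z) \<bullet> (Q *\<^sub>v (x - t \<cdot>\<^sub>v z))
        = x \<bullet> (Q *\<^sub>v x) - 2 * t * (x \<bullet> x) + t * t * (x \<bullet> z)"
      using x z Qx tz comm_scalar_prod[OF x z]
      by (simp add: minus_scalar_prod_distrib[where n = n] scalar_prod_minus_distrib[where n = n] algebra_simps)
    moreover have "0 \<le> (x - t \<cdot>\<^sub>v z) \<bullet> (Q *\<^sub>v (x - t \<cdot>\<^sub>v z))" using psd x tz by auto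
    moreover have "t * t * (x \<bullet> z) \<le> t * (x \<bullet> x)"
      using mult_left_mono[OF K(2)[OF x], of "t * t"] K(1) by (simp add: t_def z_def)
    ultimately show "1 / K * (x \<bullet> x) \<le> x \<bullet> (Q *\<^sub>v x)" unfolding t_def by linarith
  qed (use K in auto)
qed

lemma scalar_prod_self_pos:
  fixes x :: "real vec"
  assumes "x \<in> carrier_vec n" "x \<noteq> 0\<^sub>v n"
  shows "x \<bullet> x > 0"
  using conjugate_square_greater_0_vec[OF assms(1)] assms by (simp add: conjugate_vec_def)

lemma shifted_mat_mult_vec:
  fixes A :: "real mat"
  assumes "A \<in> carrier_mat n n" "y \<in> carrier_vec n"
  shows "(A - m \<cdot>\<^sub>m 1\<^sub>m n) *\<^sub>v y = A *\<^sub>v y - m \<cdot>\<^sub>v y"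
proof -
  have "(m \<cdot>\<^sub>m 1\<^sub>m n) *\<^sub>v y = m \<cdot>\<^sub>v y"
    using assms(2) by (intro eq_vecI) auto
  then show ?thesis
    using assms minus_mult_distrib_mat_vec[of A n n "m \<cdot>\<^sub>m 1\<^sub>m n" y] by simp
qed

lemma shifted_mat_symmetric:
  fixes A :: "real mat"
  assumes "A \<in> carrier_mat n n" "transpose_mat A = A"
  shows "transpose_mat (A - m \<cdot>\<^sub>m 1\<^sub>m n) = A - m \<cdot>\<^sub>m 1\<^sub>m n"
proof (rule eq_matI)
  fix i j assume "i < dim_row (A - m \<cdot>\<^sub>m 1\<^sub>m n)" "j < dim_col (A - m \<cdot>\<^sub>m 1\<^sub>m n)"
  then have ij: "i < n" "j < n" using assms(1) by auto
  then have "A $$ (j, i) = A $$ (i, j)"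
    using arg_cong[OF assms(2), of "\<lambda>M. M $$ (i, j)"] assms(1) by simp
  then show "transpose_mat (A - m \<cdot>\<^sub>m 1\<^sub>m n) $$ (i, j) = (A - m \<cdot>\<^sub>m 1\<^sub>m n) $$ (i, j)"
    using ij assms(1) by auto
qed (use assms(1) in auto)

text \<open>
  The eigenvalue is a square root of the infimum \<open>m\<close> of the Rayleigh quotient of \<open>B\<^sup>2\<close>, which is at
  most the quotient at \<open>x\<close>. The matrix \<open>B\<^sup>2 - m\<close> has to be singular: otherwise
  \<open>nonsingular_psd_bounded_below\<close> would give a lower bound for the quotient that exceeds \<open>m\<close>.
\<close>

lemma symmetric_small_eigenvalue:
  fixes B :: "real mat"
  assumes B: "B \<in> carrier_mat n n" "transpose_mat B = B"
    and x: "x \<in> carrier_vec n" "x \<noteq> 0\<^sub>v n"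
  obtains b where "eigenvalue B b" "b\<^sup>2 * (x \<bullet> x) \<le> (B *\<^sub>v x) \<bullet> (B *\<^sub>v x)"
proof -
  define q where "q y = ((B *\<^sub>v y) \<bullet> (B *\<^sub>v y)) / (y \<bullet> y)" for y
  define m where "m = Inf (q ` (carrier_vec n - {0\<^sub>v n}))"
  have nn: "0 \<le> y \<bullet> y" for y :: "real vec" by (auto simp: scalar_prod_def intro!: sum_nonneg)
  have q0: "0 \<le> q y" for y by (simp add: q_def nn)
  have m0: "0 \<le> m" unfolding m_def by (rule cInf_greatest) (use x q0 in auto)
  have bdd: "bdd_below (q ` (carrier_vec n - {0\<^sub>v n}))" using q0 by (meson bdd_belowI2)
  have m_le: "m \<le> q y" if "y \<in> carrier_vec n" "y \<noteq> 0\<^sub>v n" for y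
    unfolding m_def using that bdd by (intro cInf_lower) auto
  define Q where "Q = B * B - m \<cdot>\<^sub>m 1\<^sub>m n"
  have BB: "B * B \<in> carrier_mat n n" and Q: "Q \<in> carrier_mat n n" using B by (auto simp: Q_def)
  have Qv: "Q *\<^sub>v y = B *\<^sub>v (B *\<^sub>v y) - m \<cdot>\<^sub>v y" if "y \<in> carrier_vec n" for y
    using that B shifted_mat_mult_vec[OF BB that] by (simp add: Q_def)
  have Qt: "transpose_mat Q = Q"
    using transpose_mult[OF B(1,1)] B(2) shifted_mat_symmetric[OF BB] by (simp add: Q_def)
  have form: "y \<bullet> (Q *\<^sub>v y) = (B *\<^sub>v y) \<bullet> (B *\<^sub>v y) - m * (y \<bullet> y)" if y: "y \<in> carrier_vec n" for y
    using y B symmetric_scalar_prod[OF B y, of "B *\<^sub>v y"]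
    by (simp add: Qv scalar_prod_minus_distrib[where n = n])
  have "det Q = 0"
  proof (rule ccontr)
    assume "det Q \<noteq> 0"
    moreover have "0 \<le> y \<bullet> (Q *\<^sub>v y)" if y: "y \<in> carrier_vec n" for y
    proof (cases "y = 0\<^sub>v n")
      case False
      then show ?thesis
        using m_le[OF y False] scalar_prod_self_pos[OF y False] by (simp add: form y q_def field_simps)
    qed (use Q in auto)
    ultimately obtain c where c: "c > 0" "\<And>y. y \<in> carrier_vec n \<Longrightarrow> c * (y \<bullet> y) \<le> y \<bullet> (Q *\<^sub>v y)"
      using nonsingular_psd_bounded_below[OF Q Qt] by metis
    have "m + c \<le> Inf (q ` (carrier_vec n - {0\<^sub>v n}))"
    proof (rule cInf_greatest, goal_cases)
      case (2 r)
      then obtain y where y: "y \<in> carrier_vec n" "y \<noteq> 0\<^sub>v n" "r = q y" by auto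
      have "m + c \<le> q y"
        using c(2)[OF y(1)] scalar_prod_self_pos[OF y(1,2)] y(1)
        unfolding q_def by (simp add: form pos_le_divide_eq distrib_right)
      then show ?case using y(3) by simp
    qed (use x in auto)
    then have "m + c \<le> m" by (simp only: m_def)
    then show False using c by simp
  qed
  then obtain v where v: "v \<in> carrier_vec n" "v \<noteq> 0\<^sub>v n" "Q *\<^sub>v v = 0\<^sub>v n"
    using det_0_iff_vec_prod_zero[OF Q] by auto
  define s where "s = sqrt m"
  define w where "w = B *\<^sub>v v + s \<cdot>\<^sub>v v"
  have Bv: "B *\<^sub>v v \<in> carrier_vec n" and w: "w \<in> carrier_vec n" using B v by (auto simp: w_def)
  have BBv: "B *\<^sub>v (B *\<^sub>v v) = m \<cdot>\<^sub>v v"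
  proof (rule eq_vecI)
    fix i assume "i < dim_vec (m \<cdot>\<^sub>v v)"
    then have "i < n" using v by simp
    have "(B *\<^sub>v (B *\<^sub>v v) - m \<cdot>\<^sub>v v) $ i = 0" using v Qv \<open>i < n\<close> by auto
    then show "(B *\<^sub>v (B *\<^sub>v v)) $ i = (m \<cdot>\<^sub>v v) $ i" using v \<open>i < n\<close> B by simp
  qed (use B v in auto)
  have "B *\<^sub>v w = m \<cdot>\<^sub>v v + s \<cdot>\<^sub>v (B *\<^sub>v v)"
    unfolding w_def using B v Bv by (simp add: mult_add_distrib_mat_vec[where nr = n and nc = n] BBv mult_mat_vec)
  then have Bw: "B *\<^sub>v w = s \<cdot>\<^sub>v w"
    using v Bv B(1) m0 unfolding w_def s_def
    by (intro eq_vecI) (auto simp: algebra_simps simp flip: mult.assoc)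
  \<comment> \<open>\<open>(B - s) (B + s) v = 0\<close> with \<open>v\<close> nonzero: either \<open>B + s\<close> already kills \<open>v\<close>, or \<open>w = (B + s) v\<close>
    is an eigenvector for \<open>s\<close>.\<close>
  have "\<exists>b. eigenvalue B b \<and> b\<^sup>2 = m"
  proof (cases "w = 0\<^sub>v n")
    case True
    have "B *\<^sub>v v = (-s) \<cdot>\<^sub>v v"
    proof (rule eq_vecI)
      fix i assume "i < dim_vec (- s \<cdot>\<^sub>v v)"
      then have "i < n" using v by simp
      then have "w $ i = 0" using True by simp
      then show "(B *\<^sub>v v) $ i = (- s \<cdot>\<^sub>v v) $ i" using \<open>i < n\<close> v Bv by (simp add: w_def)
    qed (use B v in auto)
    then have "eigenvalue B (-s)" using B v by (auto simp: eigenvalue_def eigenvector_def)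
    then show ?thesis using m0 by (intro exI[of _ "-s"]) (simp add: s_def)
  next
    case False
    then have "eigenvalue B s" using B w Bw by (auto simp: eigenvalue_def eigenvector_def)
    then show ?thesis using m0 by (intro exI[of _ s]) (simp add: s_def)
  qed
  then obtain b where "eigenvalue B b" "b\<^sup>2 = m" by auto
  then show thesis
    using that[of b] m_le[OF x] scalar_prod_self_pos[OF x] by (simp add: q_def field_simps)
qed

lemma symmetric_eigenvalue_near:
  fixes A :: "real mat"
  assumes A: "A \<in> carrier_mat n n" "transpose_mat A = A"
    and x: "x \<in> carrier_vec n" "x \<noteq> 0\<^sub>v n"
  obtains l where "eigenvalue A l"
    "(l - \<mu>)\<^sup>2 * (x \<bullet> x) \<le> (\<Sum>i<n. ((A *\<^sub>v x) $ i - \<mu> * x $ i)\<^sup>2)"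
proof -
  define B where "B = A - \<mu> \<cdot>\<^sub>m 1\<^sub>m n"
  have B: "B \<in> carrier_mat n n" using A by (auto simp: B_def)
  have Bt: "transpose_mat B = B" unfolding B_def by (rule shifted_mat_symmetric[OF A])
  have Bv: "B *\<^sub>v y = A *\<^sub>v y - \<mu> \<cdot>\<^sub>v y" if "y \<in> carrier_vec n" for y
    unfolding B_def by (rule shifted_mat_mult_vec[OF A(1) that])
  obtain b where b: "eigenvalue B b" "b\<^sup>2 * (x \<bullet> x) \<le> (B *\<^sub>v x) \<bullet> (B *\<^sub>v x)"
    using symmetric_small_eigenvalue[OF B Bt x] by metis
  then obtain v where v: "v \<in> carrier_vec n" "v \<noteq> 0\<^sub>v n" "B *\<^sub>v v = b \<cdot>\<^sub>v v"
    using B by (auto simp: eigenvalue_def eigenvector_def)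
  have "A *\<^sub>v v = (b + \<mu>) \<cdot>\<^sub>v v"
  proof (rule eq_vecI)
    fix i assume "i < dim_vec ((b + \<mu>) \<cdot>\<^sub>v v)"
    then have i: "i < n" using v by simp
    have "(A *\<^sub>v v - \<mu> \<cdot>\<^sub>v v) $ i = (b \<cdot>\<^sub>v v) $ i" using v Bv by simp
    then show "(A *\<^sub>v v) $ i = ((b + \<mu>) \<cdot>\<^sub>v v) $ i" using i v A by (simp add: algebra_simps)
  qed (use A v in auto)
  then have "eigenvalue A (b + \<mu>)" using A v by (auto simp: eigenvalue_def eigenvector_def)
  moreover have "(B *\<^sub>v x) \<bullet> (B *\<^sub>v x) = (\<Sum>i<n. ((A *\<^sub>v x) $ i - \<mu> * x $ i)\<^sup>2)"
    using x A by (auto simp: Bv scalar_prod_def power2_eq_square atLeast0LessThan intro!: sum.cong)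
  ultimately show thesis using that[of "b + \<mu>"] b(2) by simp
qed

section \<open>Decay along the path\<close>

text \<open>
  Solved for \<open>u k\<close>, the recurrence gives \<open>\<bar>u k\<bar> \<ge> (\<mu> - 2) \<bar>u (k + 1)\<bar> - \<bar>u (k + 2)\<bar>\<close>. Going
  backwards from the terminal zero, \<open>\<bar>u (k + 2)\<bar> \<le> \<bar>u (k + 1)\<bar>\<close> is already known, so the factor
  per step is at least \<open>\<mu> - 3\<close>, which exceeds \<open>(\<mu> - 2) / 2\<close> exactly when \<open>\<mu> > 4\<close>.
\<close>

lemma three_term_decay:
  fixes u :: "nat \<Rightarrow> real"
  assumes mu: "\<mu> > 4" and last0: "u (Suc l) = 0"
    and rec: "\<And>k. k < l \<Longrightarrow> - u k + 2 * u (Suc k) - u (Suc (Suc k)) = \<mu> * u (Suc k)"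
  shows "\<bar>u l\<bar> \<le> (2 / (\<mu> - 2)) ^ l * \<bar>u 0\<bar>"
proof -
  let ?g = "2 / (\<mu> - 2)"
  have g: "0 < ?g" "?g < 1" using mu by auto
  have step: "\<bar>u (Suc k)\<bar> \<le> ?g * \<bar>u k\<bar>" if "k \<le> l" for k
    using that
  proof (induction rule: inc_induct)
    case base
    then show ?case using last0 g by simp
  next
    case (step k)
    have "\<bar>u (Suc (Suc k))\<bar> \<le> 1 * \<bar>u (Suc k)\<bar>"
      using step.IH g mult_right_mono[of ?g 1 "\<bar>u (Suc k)\<bar>"] by linarith
    moreover have "u k = - ((\<mu> - 2) * u (Suc k)) - u (Suc (Suc k))"
      using rec[OF step.hyps(2)] by (simp add: algebra_simps)
    then have "\<bar>u k\<bar> \<ge> \<bar>(\<mu> - 2) * u (Suc k)\<bar> - \<bar>u (Suc (Suc k))\<bar>"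
      by linarith
    moreover have "\<bar>(\<mu> - 2) * u (Suc k)\<bar> = (\<mu> - 2) * \<bar>u (Suc k)\<bar>"
      using mu by (simp add: abs_mult)
    moreover have "(\<mu> - 4) * \<bar>u (Suc k)\<bar> \<ge> 0" using mu by simp
    ultimately have "(\<mu> - 2) * \<bar>u (Suc k)\<bar> \<le> 2 * \<bar>u k\<bar>" by (simp add: algebra_simps)
    then show ?case using mu by (simp add: field_simps)
  qed
  have "k \<le> l \<Longrightarrow> \<bar>u k\<bar> \<le> ?g ^ k * \<bar>u 0\<bar>" for k
  proof (induction k)
    case (Suc k)
    then have "\<bar>u (Suc k)\<bar> \<le> ?g * (?g ^ k * \<bar>u 0\<bar>)"
      using step[of k] g by (meson Suc_leD mult_left_mono less_imp_le order_trans)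
    then show ?case by (simp add: mult.assoc)
  qed simp
  then show ?thesis by simp
qed

text \<open>
  Here \<open>p 0\<close> is the vertex to which the path is attached, \<open>p 1, \<dots>, p l\<close> are the path vertices, and
  \<open>p (l + 1)\<close> is the first vertex outside the support of \<open>x\<close>. The residual lives at \<open>p (l + 1)\<close>
  only and equals minus the entry at \<open>p l\<close>, which the decay bounds in terms of the entry at \<open>p 0\<close>
  and thus in terms of the norm of \<open>x\<close>.
\<close>

lemma eigenvalue_near_path_end:
  fixes L :: "real mat" and p :: "nat \<Rightarrow> nat"
  assumes L: "L \<in> carrier_mat n n" "transpose_mat L = L"
    and x: "x \<in> carrier_vec n" "x \<noteq> 0\<^sub>v n"
    and mu: "\<mu> > 4"
    and p: "p 0 < n" "p (Suc l) < n" "\<And>k. k < l \<Longrightarrow> p (Suc k) < n \<and> p (Suc k) \<noteq> p (Suc l)"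
    and path: "\<And>k. k < l \<Longrightarrow>
      (L *\<^sub>v x) $ p (Suc k) = - x $ p k + 2 * x $ p (Suc k) - x $ p (Suc (Suc k))"
    and eig: "\<And>i. i < n \<Longrightarrow> i \<noteq> p (Suc l) \<Longrightarrow> (L *\<^sub>v x) $ i = \<mu> * x $ i"
    and past: "x $ p (Suc l) = 0" "(L *\<^sub>v x) $ p (Suc l) = - x $ p l"
  obtains \<nu> where "eigenvalue L \<nu>" "\<bar>\<nu> - \<mu>\<bar> \<le> (2 / (\<mu> - 2)) ^ l"
proof -
  let ?g = "2 / (\<mu> - 2)"
  have g: "?g \<ge> 0" using mu by auto
  have "\<bar>x $ p l\<bar> \<le> ?g ^ l * \<bar>x $ p 0\<bar>"
    using three_term_decay[of \<mu> "\<lambda>k. x $ p k" l] mu past(1) path eig p by simp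
  then have "(x $ p l)\<^sup>2 \<le> (?g ^ l * \<bar>x $ p 0\<bar>)\<^sup>2" using g by (simp add: abs_le_square_iff[symmetric] abs_mult)
  also have "\<dots> = (?g ^ l)\<^sup>2 * (x $ p 0)\<^sup>2" by (simp add: power_mult_distrib)
  also have "\<dots> \<le> (?g ^ l)\<^sup>2 * (x \<bullet> x)"
    using x p(1)
    by (intro mult_left_mono) (auto simp: scalar_prod_def power2_eq_square intro!: member_le_sum)
  finally have decay: "(x $ p l)\<^sup>2 \<le> (?g ^ l)\<^sup>2 * (x \<bullet> x)" .
  obtain \<nu> where ev: "eigenvalue L \<nu>"
    and near: "(\<nu> - \<mu>)\<^sup>2 * (x \<bullet> x) \<le> (\<Sum>i<n. ((L *\<^sub>v x) $ i - \<mu> * x $ i)\<^sup>2)"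
    using symmetric_eigenvalue_near[OF L x] by metis
  have "(\<Sum>i<n. ((L *\<^sub>v x) $ i - \<mu> * x $ i)\<^sup>2) = (\<Sum>i<n. if i = p (Suc l) then (x $ p l)\<^sup>2 else 0)"
    using eig past by (intro sum.cong) auto
  also have "\<dots> = (x $ p l)\<^sup>2" using p(2) by simp
  finally have "(\<nu> - \<mu>)\<^sup>2 * (x \<bullet> x) \<le> (?g ^ l)\<^sup>2 * (x \<bullet> x)" using near decay by simp
  then have "(\<nu> - \<mu>)\<^sup>2 \<le> (?g ^ l)\<^sup>2" using scalar_prod_self_pos[OF x] by simp
  then have "\<bar>\<nu> - \<mu>\<bar> \<le> ?g ^ l" using g by (simp add: abs_le_square_iff[symmetric])
  then show thesis using that ev by blast
qed

section \<open>Contiguous principal submatrices and the block form\<close>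

lemma pick_atLeastLessThan:
  assumes "i < b - a"
  shows "pick {a..<b} i = a + i"
proof -
  have "{c \<in> {a..<b}. c < a + i} = {a..<a + i}" using assms by auto
  then show ?thesis using pick_card_in_set[of "a + i" "{a..<b}"] assms by simp
qed

lemma contiguous_submatrix:
  assumes "A \<in> carrier_mat n n" "b \<le> n"
  shows "submatrix A {a..<b} {a..<b} = mat (b - a) (b - a) (\<lambda>(i, j). A $$ (a + i, a + j))"
proof -
  have "{i. i < n \<and> i \<in> {a..<b}} = {a..<b}" using assms by auto
  then have "submatrix A {a..<b} {a..<b}
      = mat (b - a) (b - a) (\<lambda>(i, j). A $$ (pick {a..<b} i, pick {a..<b} j))"
    using assms(1) by (simp add: submatrix_def)
  also have "\<dots> = mat (b - a) (b - a) (\<lambda>(i, j). A $$ (a + i, a + j))"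
    by (rule cong_mat) (simp_all add: pick_atLeastLessThan)
  finally show ?thesis .
qed

lemma eigenvalue_submatrix_pad:
  fixes A :: "real mat"
  assumes A: "A \<in> carrier_mat n n" and b: "b \<le> n"
    and ev: "eigenvalue (submatrix A {a..<b} {a..<b}) \<mu>"
  obtains x where "x \<in> carrier_vec n" "x \<noteq> 0\<^sub>v n"
    "\<And>i. i < n \<Longrightarrow> i \<notin> {a..<b} \<Longrightarrow> x $ i = 0"
    "\<And>i. i \<in> {a..<b} \<Longrightarrow> (A *\<^sub>v x) $ i = \<mu> * x $ i"
proof -
  define m where "m = b - a"
  define S where "S = mat m m (\<lambda>(i, j). A $$ (a + i, a + j))"
  have S: "S \<in> carrier_mat m m" by (simp add: S_def)
  obtain v where v: "v \<in> carrier_vec m" "v \<noteq> 0\<^sub>v m" "S *\<^sub>v v = \<mu> \<cdot>\<^sub>v v"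
    using ev S unfolding contiguous_submatrix[OF A b] m_def[symmetric] S_def[symmetric]
    by (auto simp: eigenvalue_def eigenvector_def)
  define x where "x = vec n (\<lambda>i. if i \<in> {a..<b} then v $ (i - a) else 0)"
  obtain k where k: "k < m" "v $ k \<noteq> 0" using v by (metis carrier_vecD eq_vecI index_zero_vec)
  show thesis
  proof (rule that[of x])
    have "x $ (a + k) = v $ k" using k b by (simp add: x_def m_def)
    then show "x \<noteq> 0\<^sub>v n" using k b by (auto simp: m_def)
  next
    fix i assume i: "i \<in> {a..<b}"
    have "(A *\<^sub>v x) $ i = (\<Sum>j = 0..<n. A $$ (i, j) * x $ j)"
      using i b A by (simp add: scalar_prod_def x_def)
    also have "\<dots> = (\<Sum>j = a..<b. A $$ (i, j) * x $ j)"
      using b by (intro sum.mono_neutral_right) (auto simp: x_def)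
    also have "\<dots> = (\<Sum>j = 0..<m. A $$ (i, a + j) * v $ j)"
      using b i by (intro sum.reindex_bij_witness[of _ "\<lambda>j. a + j" "\<lambda>j. j - a"])
        (auto simp: x_def m_def)
    also have "\<dots> = (S *\<^sub>v v) $ (i - a)"
      using i b v(1) by (auto simp: scalar_prod_def S_def m_def intro!: sum.cong)
    also have "\<dots> = \<mu> * x $ i" using v i b by (auto simp: x_def m_def)
    finally show "(A *\<^sub>v x) $ i = \<mu> * x $ i" .
  qed (auto simp: x_def)
qed

text \<open>
  Each row that matters below meets the support of \<open>x\<close> in at most three columns.
\<close>

lemma mult_mat_vec_support:
  fixes A :: "real mat"
  assumes "A \<in> carrier_mat n n" "x \<in> carrier_vec n" "i < n" "J \<subseteq> {..<n}"
    and "\<And>j. j < n \<Longrightarrow> j \<notin> J \<Longrightarrow> A $$ (i, j) * x $ j = 0"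
  shows "(A *\<^sub>v x) $ i = (\<Sum>j\<in>J. A $$ (i, j) * x $ j)"
proof -
  have "(A *\<^sub>v x) $ i = (\<Sum>j\<in>{..<n}. A $$ (i, j) * x $ j)"
    using assms by (simp add: scalar_prod_def atLeast0LessThan)
  also have "\<dots> = (\<Sum>j\<in>J. A $$ (i, j) * x $ j)"
    using assms by (intro sum.mono_neutral_right) auto
  finally show ?thesis .
qed

lemma graph_laplacian_symmetric:
  assumes "graph G"
  shows "transpose_mat (graph_laplacian G vs) = graph_laplacian G vs"
proof -
  interpret graph G by fact
  have "u \<rightarrow>\<^bsub>G\<^esub> v \<longleftrightarrow> v \<rightarrow>\<^bsub>G\<^esub> u" for u v
    using sym_arcs by (auto simp: symmetric_def sym_def)
  then show ?thesis
    by (auto simp: graph_laplacian_def degree_mat_def adjacency_mat_def mat_diag_def intro!: eq_matI)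
qed

lemma three_block_mat_index:
  assumes "A11 \<in> carrier_mat n1 n1" "A22 \<in> carrier_mat n2 n2" "A33 \<in> carrier_mat n3 n3"
    and "A13 \<in> carrier_mat n1 n3" "A23 \<in> carrier_mat n2 n3"
    and "A31 \<in> carrier_mat n3 n1" "A32 \<in> carrier_mat n3 n2"
    and "i < n1 + n2 + n3" "j < n1 + n2 + n3"
  shows "three_block_mat A11 A12 A13 A21 A22 A23 A31 A32 A33 $$ (i, j) =
    (if i < n1 then
       if j < n1 then A11 $$ (i, j)
       else if j < n1 + n2 then A12 $$ (i, j - n1) else A13 $$ (i, j - (n1 + n2))
     else if i < n1 + n2 then
       if j < n1 then A21 $$ (i - n1, j)
       else if j < n1 + n2 then A22 $$ (i - n1, j - n1) else A23 $$ (i - n1, j - (n1 + n2))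
     else
       if j < n1 then A31 $$ (i - (n1 + n2), j)
       else if j < n1 + n2 then A32 $$ (i - (n1 + n2), j - n1)
       else A33 $$ (i - (n1 + n2), j - (n1 + n2)))"
proof -
  have right: "(A13 @\<^sub>r A23) $$ (i, k) = (if i < n1 then A13 $$ (i, k) else A23 $$ (i - n1, k))"
    if "i < n1 + n2" "k < n3" for k
    using assms that by (simp add: append_rows_def)
  have below: "transpose_mat (transpose_mat A31 @\<^sub>r transpose_mat A32) $$ (k, j)
      = (if j < n1 then A31 $$ (k, j) else A32 $$ (k, j - n1))" if "j < n1 + n2" "k < n3" for k
    using assms that by (simp add: append_rows_def)
  show ?thesis
    unfolding three_block_mat_def using assms by (simp add: right below)
qed

text \<open>
  The part of \<open>L\<close> outside the blocks \<open>L1\<close> and \<open>L3\<close>. In the path rows the corners of the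
  off-diagonal blocks continue the tridiagonal pattern past the ends of the middle block, so the
  recurrence holds at the end vertices of the path as well.
\<close>

lemma three_block_path_entries:
  fixes L1 L3 :: "real mat"
  assumes L1: "L1 \<in> carrier_mat l1 l1" and L3: "L3 \<in> carrier_mat l3 l3"
    and l: "l1 \<ge> 1" "l2 \<ge> 1" "l3 \<ge> 1"
    and L: "L = three_block_mat
               L1                            (transpose_mat (corner_mat l2 l1))  (0\<^sub>m l1 l3)
               (corner_mat l2 l1)  (path_mat l2)                 (transpose_mat (corner_mat l3 l2))
               (0\<^sub>m l3 l1)         (corner_mat l3 l2)            L3"
    and n: "n = l1 + l2 + l3"
  shows "L \<in> carrier_mat n n"
    and "\<And>i j. l1 \<le> i \<Longrightarrow> i < l1 + l2 \<Longrightarrow> j < n \<Longrightarrow>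
      L $$ (i, j) = (if j = i then 2 else if Suc j = i \<or> j = Suc i then -1 else 0)"
    and "\<And>i j. l1 + l2 \<le> i \<Longrightarrow> i < n \<Longrightarrow> j < l1 + l2 \<Longrightarrow>
      L $$ (i, j) = (if i = l1 + l2 \<and> Suc j = l1 + l2 then -1 else 0)"
    and "\<And>i j. i < l1 \<Longrightarrow> l1 \<le> j \<Longrightarrow> j < n \<Longrightarrow>
      L $$ (i, j) = (if Suc i = l1 \<and> j = l1 then -1 else 0)"
proof -
  have carrier: "path_mat l2 \<in> carrier_mat l2 l2" "transpose_mat (corner_mat l3 l2) \<in> carrier_mat l2 l3"
    "corner_mat l3 l2 \<in> carrier_mat l3 l2"
    by (simp_all add: path_mat_def corner_mat_def)
  note index = three_block_mat_index[OF L1 carrier(1) L3 zero_carrier_mat carrier(2)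
      zero_carrier_mat carrier(3), folded n, of _ _ "transpose_mat (corner_mat l2 l1)" "corner_mat l2 l1",
      folded L]
  have corner: "corner_mat r c $$ (i, j) = (if i = 0 \<and> Suc j = c then -1 else 0)"
    if "i < r" "j < c" for r c i j
    using that by (simp add: corner_mat_def)
  have dim: "dim_row (corner_mat r c) = r" "dim_col (corner_mat r c) = c" for r c
    by (simp_all add: corner_mat_def)
  show "L \<in> carrier_mat n n"
    using L1 L3 by (auto simp: L n three_block_mat_def corner_mat_def path_mat_def)
  fix i j
  {
    assume i: "l1 \<le> i" "i < l1 + l2" and j: "j < n"
    consider "j < l1" | "l1 \<le> j" "j < l1 + l2" | "l1 + l2 \<le> j" by linarith
    then show "L $$ (i, j) = (if j = i then 2 else if Suc j = i \<or> j = Suc i then -1 else 0)"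
    proof cases
      case 1
      then have "L $$ (i, j) = corner_mat l2 l1 $$ (i - l1, j)" using i j n by (simp add: index)
      then show ?thesis using corner[of "i - l1" l2 j l1] 1 i by auto
    next
      case 2
      then have "L $$ (i, j) = path_mat l2 $$ (i - l1, j - l1)" using i j n by (simp add: index)
      moreover have "i - l1 = j - l1 \<longleftrightarrow> j = i" "Suc (i - l1) = j - l1 \<longleftrightarrow> j = Suc i"
        "Suc (j - l1) = i - l1 \<longleftrightarrow> Suc j = i"
        using 2 i by arith+
      moreover have "i - l1 < l2" "j - l1 < l2" using 2 i by arith+
      ultimately show ?thesis by (simp add: path_mat_def disj_commute)
    next
      case 3
      then have "L $$ (i, j) = transpose_mat (corner_mat l3 l2) $$ (i - l1, j - (l1 + l2))"
        using i j n by (simp add: index)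
      also have "\<dots> = corner_mat l3 l2 $$ (j - (l1 + l2), i - l1)"
        using 3 i j n by (simp add: dim)
      finally show ?thesis using corner[of "j - (l1 + l2)" l3 "i - l1" l2] 3 i j n by auto
    qed
  next
    assume i: "l1 + l2 \<le> i" "i < n" and j: "j < l1 + l2"
    show "L $$ (i, j) = (if i = l1 + l2 \<and> Suc j = l1 + l2 then -1 else 0)"
    proof (cases "j < l1")
      case True
      then have "L $$ (i, j) = 0" using i n by (simp add: index)
      then show ?thesis using True l by auto
    next
      case False
      then have "L $$ (i, j) = corner_mat l3 l2 $$ (i - (l1 + l2), j - l1)"
        using i j n by (simp add: index)
      then show ?thesis using corner[of "i - (l1 + l2)" l3 "j - l1" l2] False i j n by auto
    qed
  next
    assume i: "i < l1" and j: "l1 \<le> j" "j < n"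
    show "L $$ (i, j) = (if Suc i = l1 \<and> j = l1 then -1 else 0)"
    proof (cases "j < l1 + l2")
      case True
      then have "L $$ (i, j) = transpose_mat (corner_mat l2 l1) $$ (i, j - l1)"
        using i j n by (simp add: index)
      also have "\<dots> = corner_mat l2 l1 $$ (j - l1, i)" using True i j by (simp add: dim)
      finally show ?thesis using corner[of "j - l1" l2 i l1] True i j by auto
    next
      case False
      then have "L $$ (i, j) = 0" using i j n by (simp add: index)
      then show ?thesis using False l by auto
    qed
  }
qed

theorem theorem6p1:
  fixes G :: "('a, 'b) pre_digraph" and vs :: "'a list"
    and L L1 L2 L3 E1 E2 :: "real mat"
    and l1 l2 l3 :: nat
    and lt :: real
  assumes "graph G"
    and "distinct vs" and "set vs = verts G"
    and "L = graph_laplacian G vs"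
    and "l1 \<ge> 1" and "l2 \<ge> 1" and "l3 \<ge> 1"
    and "L1 \<in> carrier_mat l1 l1" and "L3 \<in> carrier_mat l3 l3"
    and "L2 = path_mat l2"
    and "E1 = corner_mat l2 l1" and "E2 = corner_mat l3 l2"
    and "L = three_block_mat
               L1            (transpose_mat E1)  (0\<^sub>m l1 l3)
               E1            L2                  (transpose_mat E2)
               (0\<^sub>m l3 l1)  E2                  L3"
    and "lt > 4"
    and "eigenvalue (submatrix L {0..<l1 + l2} {0..<l1 + l2}) lt \<or>
         eigenvalue (submatrix L {l1..<l1 + l2 + l3} {l1..<l1 + l2 + l3}) lt"
  shows "2 / (lt - 2) < 1 \<and>
         (\<exists>l. eigenvalue L l \<and> \<bar>l - lt\<bar> \<le> (2 / (lt - 2)) ^ l2)"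
proof
  show "2 / (lt - 2) < 1" using \<open>lt > 4\<close> by simp
next
  define n where "n = l1 + l2 + l3"
  note l = \<open>l1 \<ge> 1\<close> \<open>l2 \<ge> 1\<close> \<open>l3 \<ge> 1\<close>
  note entries = three_block_path_entries[OF assms(8,9) l assms(13)[unfolded assms(10-12)] n_def]
  note L = entries(1)
  have Lt: "transpose_mat L = L"
    using graph_laplacian_symmetric[OF assms(1)] assms(4) by simp
  have path_row: "(L *\<^sub>v x) $ i = - x $ (i - 1) + 2 * x $ i - x $ (i + 1)"
    if x: "x \<in> carrier_vec n" and i: "l1 \<le> i" "i < l1 + l2" for x i
  proof -
    obtain h where h: "i = Suc h" using i l by (cases i) auto
    have "(L *\<^sub>v x) $ i = (\<Sum>j\<in>{h, Suc h, Suc (Suc h)}. L $$ (i, j) * x $ j)"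
      using i l h by (intro mult_mat_vec_support[OF L x]) (auto simp: entries(2) n_def)
    also have "\<dots> = - x $ h + 2 * x $ Suc h - x $ Suc (Suc h)"
      using i l h by (simp add: entries(2) n_def)
    finally show ?thesis by (simp add: h)
  qed
  show "\<exists>l. eigenvalue L l \<and> \<bar>l - lt\<bar> \<le> (2 / (lt - 2)) ^ l2"
    using assms(15)
  proof
    assume "eigenvalue (submatrix L {0..<l1 + l2} {0..<l1 + l2}) lt"
    then obtain x where x: "x \<in> carrier_vec n" "x \<noteq> 0\<^sub>v n"
      and out: "\<And>i. i < n \<Longrightarrow> i \<notin> {0..<l1 + l2} \<Longrightarrow> x $ i = 0"
      and eig: "\<And>i. i \<in> {0..<l1 + l2} \<Longrightarrow> (L *\<^sub>v x) $ i = lt * x $ i"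
      using eigenvalue_submatrix_pad[OF L, of "l1 + l2" 0 lt] unfolding n_def by auto
    have beyond: "(L *\<^sub>v x) $ i = (if i = l1 + l2 then - x $ (l1 + l2 - 1) else 0)"
      if i: "l1 + l2 \<le> i" "i < n" for i
    proof -
      have "(L *\<^sub>v x) $ i = (\<Sum>j\<in>{l1 + l2 - 1}. L $$ (i, j) * x $ j)"
      proof (intro mult_mat_vec_support[OF L x(1)])
        fix j assume "j < n" "j \<notin> {l1 + l2 - 1}"
        then show "L $$ (i, j) * x $ j = 0"
          using i l out[of j] entries(3)[of i j] by (cases "j < l1 + l2") auto
      qed (use i l n_def in auto)
      then show ?thesis using i l by (auto simp: entries(3))
    qed
    \<comment> \<open>From the last vertex of the first block through the path to the first vertex of the third.\<close>
    show ?thesis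
    proof (rule eigenvalue_near_path_end[OF L Lt x \<open>lt > 4\<close>, of "\<lambda>k. l1 - 1 + k" l2])
      fix i assume i: "i < n" "i \<noteq> l1 - 1 + Suc l2"
      then show "(L *\<^sub>v x) $ i = lt * x $ i"
        using l eig[of i] beyond[of i] out[of i] by (cases "i < l1 + l2") auto
    next
      fix k assume "k < l2"
      then show "(L *\<^sub>v x) $ (l1 - 1 + Suc k)
          = - x $ (l1 - 1 + k) + 2 * x $ (l1 - 1 + Suc k) - x $ (l1 - 1 + Suc (Suc k))"
        using path_row[OF x(1), of "l1 + k"] l by simp
    qed (use l out beyond[of "l1 + l2"] in \<open>auto simp: n_def\<close>)
  next
    assume "eigenvalue (submatrix L {l1..<l1 + l2 + l3} {l1..<l1 + l2 + l3}) lt"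
    then obtain x where x: "x \<in> carrier_vec n" "x \<noteq> 0\<^sub>v n"
      and out: "\<And>i. i < n \<Longrightarrow> i \<notin> {l1..<n} \<Longrightarrow> x $ i = 0"
      and eig: "\<And>i. i \<in> {l1..<n} \<Longrightarrow> (L *\<^sub>v x) $ i = lt * x $ i"
      using eigenvalue_submatrix_pad[OF L, of n l1 lt] unfolding n_def by auto
    have before: "(L *\<^sub>v x) $ i = (if i = l1 - 1 then - x $ l1 else 0)" if i: "i < l1" for i
    proof -
      have "(L *\<^sub>v x) $ i = (\<Sum>j\<in>{l1}. L $$ (i, j) * x $ j)"
      proof (intro mult_mat_vec_support[OF L x(1)])
        fix j assume "j < n" "j \<notin> {l1}"
        then show "L $$ (i, j) * x $ j = 0"
          using i l out[of j] entries(4)[of i j] by (cases "l1 \<le> j") auto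
      qed (use i l n_def in auto)
      then show ?thesis using i l by (auto simp: entries(4) n_def)
    qed
    \<comment> \<open>The path backwards: from the first vertex of the third block to the last of the first.\<close>
    show ?thesis
    proof (rule eigenvalue_near_path_end[OF L Lt x \<open>lt > 4\<close>, of "\<lambda>k. l1 + l2 - k" l2])
      fix i assume i: "i < n" "i \<noteq> l1 + l2 - Suc l2"
      then show "(L *\<^sub>v x) $ i = lt * x $ i"
        using l eig[of i] before[of i] out[of i] by (cases "l1 \<le> i") auto
    next
      fix k assume "k < l2"
      then show "(L *\<^sub>v x) $ (l1 + l2 - Suc k)
          = - x $ (l1 + l2 - k) + 2 * x $ (l1 + l2 - Suc k) - x $ (l1 + l2 - Suc (Suc k))"
        using path_row[OF x(1), of "l1 + l2 - Suc k"] l by (simp add: Suc_diff_Suc)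
    qed (use l out before[of "l1 - 1"] in \<open>auto simp: n_def\<close>)
  qed
qed

end
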